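(* Let $\beta>0$ and, for a sufficiently smooth decaying function $F=F(r,z,t)$ ($r>0$, $z\in\mathbb R$) and $\lambda>0$, define the Navier–Stokes rescaling $$F_\lambda(r,z,t)=\lambda^2F(\lambda r,\lambda z,\lambda^2t).$$ Write $S[F]=\partial_z(F^2)$. Then the viscous term $\nu\|\nabla F\|_{L^2(d\mu_5)}^2$ scales like $\lambda$ and the response term $\frac{m\kappa}{2}\|\mathcal A^{-\beta/2}S[F]\|_{L^2(d\mu_5)}^2$ scales like $\lambda^{5-2\beta}$; that is, $$\|\nabla F_\lambda(t)\|_{L^2(d\mu_5)}^2=\lambda\,\|\nabla F(\lambda^2t)\|_{L^2(d\mu_5)}^2,\qquad \|\mathcal A^{-\beta/2}S[F_\lambda](t)\|_{L^2(d\mu_5)}^2=\lambda^{5-2\beta}\,\|\mathcal A^{-\beta/2}S[F](\lambda^2t)\|_{L^2(d\mu_5)}^2 .$$ Hence the response term is scale-critical relative to the viscous term (the two scaling exponents are equal) exactly when $\beta=2$; it is supercritical (response exponent larger than the viscous exponent) for $\beta<2$ and subcritical (response exponent smaller) for $\beta>2$.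
   Context: $\nabla=(\partial_r,\partial_z)$, $d\mu_5=r^3\,dr\,dz$, $\mathcal A=-\Delta_5$ with $\Delta_5=\partial_{rr}+\frac3r\partial_r+\partial_{zz}$. Functions of $(r,z)$ are identified with functions on $\mathbb R^5=\mathbb R^4\times\mathbb R$ radial in the first four variables, so $\Delta_5$ is the Laplacian on $\mathbb R^5$ and powers of $\mathcal A$ are Fourier multipliers $|\xi|^{2s}$. "Sufficiently smooth decaying" includes that both norms are well defined and finite. The constants $\nu>0$, $m,\kappa\in\mathbb R$ are the coefficients of the viscous and response terms in the energy balance $\frac12\frac{d}{dt}\|F\|_{L^2(d\mu_5)}^2+\nu\|\nabla F\|_{L^2(d\mu_5)}^2=\frac{m\kappa}{2}\|\mathcal A^{-\beta/2}\partial_z(F^2)\|_{L^2(d\mu_5)}^2$ for the model $F_t+b_m[\Phi]\cdot\nabla F=\nu\Delta_5F+2\Phi_zF$, $\Phi=-\kappa\mathcal A^{-\beta}\partial_z(F^2)$, $b_m[\Phi]=(-r\Phi_z,\,m\Phi+r\Phi_r)$; they do not depend on $\lambda$. *)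

theory Defs
  imports "HOL-Analysis.Analysis"
begin

text \<open>
  Spatial profiles are functions of \<open>(r, z)\<close>, used only for \<open>r > 0\<close>; their values for
  \<open>r \<le> 0\<close> never matter.  All measures are completed (\<^const>\<open>lebesgue\<close>), so that arbitrary
  values on the null set \<open>r = 0\<close> cannot spoil measurability.
\<close>

definition mu5 :: "(real \<times> real) measure" where
  "mu5 = density (lebesgue_on {p. fst p > 0}) (\<lambda>(r, z). ennreal (r ^ 3))"

definition L2_mu5 :: "(real \<times> real \<Rightarrow> 'a::euclidean_space) \<Rightarrow> bool" where
  "L2_mu5 u \<longleftrightarrow> u \<in> borel_measurable mu5 \<and> integrable mu5 (\<lambda>p. (norm (u p))\<^sup>2)"

definition L2_norm_mu5 :: "(real \<times> real \<Rightarrow> 'a::euclidean_space) \<Rightarrow> real" where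
  "L2_norm_mu5 u = sqrt (\<integral>p. (norm (u p))\<^sup>2 \<partial>mu5)"

definition grad :: "(real \<times> real \<Rightarrow> real) \<Rightarrow> real \<times> real \<Rightarrow> real \<times> real" where
  "grad f = (\<lambda>(r, z). (deriv (\<lambda>s. f (s, z)) r, deriv (\<lambda>w. f (r, w)) z))"

definition source :: "(real \<times> real \<Rightarrow> real) \<Rightarrow> real \<times> real \<Rightarrow> real" where
  "source f = (\<lambda>(r, z). deriv (\<lambda>w. (f (r, w))\<^sup>2) z)"

text \<open>Functions of \<open>(r, z)\<close> as functions on \<open>\<real>\<^sup>4 \<times> \<real>\<close> that are radial in the first four variables.\<close>

type_synonym R5 = "(real ^ 4) \<times> real"

definition lift5 :: "(real \<times> real \<Rightarrow> 'a) \<Rightarrow> R5 \<Rightarrow> 'a" where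
  "lift5 g = (\<lambda>(x, z). g (norm x, z))"

text \<open>
  The inverse identification evaluates at \<open>(r e\<^sub>1, z)\<close>; for a function radial in the first
  four variables the choice of unit vector is immaterial.
\<close>

definition restrict5 :: "(R5 \<Rightarrow> 'a) \<Rightarrow> real \<times> real \<Rightarrow> 'a" where
  "restrict5 u = (\<lambda>(r, z). u (r *\<^sub>R axis 1 1, z))"

text \<open>With this normalisation the symbol of \<open>-\<Delta>\<^sub>5\<close> is exactly \<open>|\<xi>|\<^sup>2\<close>.\<close>

definition fourier5 :: "(R5 \<Rightarrow> complex) \<Rightarrow> R5 \<Rightarrow> complex" where
  "fourier5 g \<xi> = (\<integral>x. cis (- (\<xi> \<bullet> x)) * g x \<partial>lebesgue)"

definition inv_fourier5 :: "(R5 \<Rightarrow> complex) \<Rightarrow> R5 \<Rightarrow> complex" where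
  "inv_fourier5 h x = (\<integral>\<xi>. cis (\<xi> \<bullet> x) * h \<xi> \<partial>lebesgue) / (2 * pi) ^ 5"

text \<open>
  The power \<open>\<A>\<^sup>s\<close> of \<open>\<A> = -\<Delta>\<^sub>5\<close> is the Fourier multiplier \<open>|\<xi>|\<^bsup>2s\<^esup>\<close>.  The value of the symbol
  at \<open>\<xi> = 0\<close> (zero, by the convention for \<^term>\<open>(powr)\<close>) is irrelevant.
  The formula is meaningful when \<open>A_pow_defined\<close> holds, that is, when both Fourier integrals
  converge absolutely.
\<close>

definition A_pow_symbol :: "real \<Rightarrow> (real \<times> real \<Rightarrow> real) \<Rightarrow> R5 \<Rightarrow> complex" where
  "A_pow_symbol s g \<xi> =
     complex_of_real (norm \<xi> powr (2 * s)) * fourier5 (lift5 (\<lambda>p. complex_of_real (g p))) \<xi>"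

definition A_pow :: "real \<Rightarrow> (real \<times> real \<Rightarrow> real) \<Rightarrow> real \<times> real \<Rightarrow> complex" where
  "A_pow s g = restrict5 (inv_fourier5 (A_pow_symbol s g))"

definition A_pow_defined :: "real \<Rightarrow> (real \<times> real \<Rightarrow> real) \<Rightarrow> bool" where
  "A_pow_defined s g \<longleftrightarrow>
     integrable lebesgue (lift5 g) \<and> integrable lebesgue (A_pow_symbol s g)"

text \<open>
  What ``sufficiently smooth decaying'' has to provide: the derivatives exist in the classical
  sense, and both norms are well defined and finite.
\<close>

definition smooth_decaying :: "real \<Rightarrow> (real \<times> real \<Rightarrow> real) \<Rightarrow> bool" where
  "smooth_decaying \<beta> f \<longleftrightarrow>
     (\<forall>r z. r > 0 \<longrightarrow> f differentiable (at (r, z))) \<and>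
     L2_mu5 (grad f) \<and>
     A_pow_defined (- \<beta> / 2) (source f) \<and>
     L2_mu5 (A_pow (- \<beta> / 2) (source f))"

definition viscous_term :: "real \<Rightarrow> (real \<times> real \<Rightarrow> real) \<Rightarrow> real" where
  "viscous_term \<nu> f = \<nu> * (L2_norm_mu5 (grad f))\<^sup>2"

definition response_term :: "real \<Rightarrow> real \<Rightarrow> real \<Rightarrow> (real \<times> real \<Rightarrow> real) \<Rightarrow> real" where
  "response_term m \<kappa> \<beta> f = m * \<kappa> / 2 * (L2_norm_mu5 (A_pow (- \<beta> / 2) (source f)))\<^sup>2"

definition slice :: "(real \<Rightarrow> real \<Rightarrow> real \<Rightarrow> real) \<Rightarrow> real \<Rightarrow> real \<times> real \<Rightarrow> real" where
  "slice F t = (\<lambda>(r, z). F r z t)"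

definition ns_rescale ::
  "real \<Rightarrow> (real \<Rightarrow> real \<Rightarrow> real \<Rightarrow> real) \<Rightarrow> real \<Rightarrow> real \<Rightarrow> real \<Rightarrow> real" where
  "ns_rescale l F = (\<lambda>r z t. l\<^sup>2 * F (l * r) (l * z) (l\<^sup>2 * t))"

text \<open>
  The term \<open>N\<close> of the energy balance scales like \<open>\<lambda>\<^sup>p\<close> along the rescalings of \<open>F\<close>, where
  \<open>F\<close> is given on the time set \<open>I\<close>; the rescaled function then lives on \<open>{t. \<lambda>\<^sup>2 t \<in> I}\<close>.
\<close>

definition scales_like ::
  "((real \<times> real \<Rightarrow> real) \<Rightarrow> real) \<Rightarrow> real set \<Rightarrow> (real \<Rightarrow> real \<Rightarrow> real \<Rightarrow> real) \<Rightarrow> real \<Rightarrow> bool" where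
  "scales_like N I F p \<longleftrightarrow>
     (\<forall>l t. l > 0 \<longrightarrow> l\<^sup>2 * t \<in> I \<longrightarrow>
        N (slice (ns_rescale l F) t) = l powr p * N (slice F (l\<^sup>2 * t)))"

end

theory Submission
  imports Defs
begin

text \<open>
  All three operations in the two terms --- differentiation, the Fourier transform and the
  \<open>L\<^sup>2\<close> norm --- are equivariant under dilations, so each contributes a power of \<open>l\<close>.  Put
  \<open>f\<^sub>l p = l\<^sup>2 f (l p)\<close>.  Then \<open>\<nabla> f\<^sub>l = l\<^sup>3 (\<nabla> f) (l \<cdot>)\<close>, and \<open>S[f\<^sub>l] = l\<^sup>5 S[f] (l \<cdot>)\<close> because the
  source is quadratic with one derivative; the operator \<open>\<A>\<^sup>s\<close> is homogeneous of degree \<open>2s\<close>.  Both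
  \<open>r\<^sup>3 dr dz\<close> and Lebesgue measure on \<open>\<real>\<^sup>5\<close> have degree five, so a squared norm picks up
  \<open>l\<close> to the power \<open>-5\<close>.  The exponents are therefore \<open>2\<cdot>3 - 5 = 1\<close> and, with \<open>s = -\<beta>/2\<close>,
  \<open>2\<cdot>(5 - \<beta>) - 5 = 5 - 2\<beta>\<close>.

  The measure-theoretic input is isolated in \<open>homogeneous_measure\<close>: its change of variables
  (\<open>integrable_dilation_iff\<close>, \<open>integral_dilation\<close>) serves both the Fourier integrals and the norms.
  The behaviour of \<open>\<A>\<^sup>s\<close> is \<open>A_pow_dilation\<close>.  Profiles are only controlled for \<open>r > 0\<close>, so on
  \<open>\<real>\<^sup>5\<close> the scaling relation of the source is known only off the axis \<open>x = 0\<close>; this is a null set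
  and the Fourier integral does not see it.  Finally, evaluating at \<open>l = 2\<close> shows that a term with
  a nonzero value has at most one exponent (\<open>scales_like_unique\<close>), which makes the comparison
  of exponents independent of how they were found.
\<close>

section \<open>Homogeneous measures\<close>

text \<open>
  Dilating by \<open>l\<close> multiplies the measure of a set by \<open>l ^ d\<close>.  Writing this as an identity of
  measures lets the integral rules for pushforwards and densities be used directly.
\<close>

definition homogeneous_measure :: "'a::real_normed_vector measure \<Rightarrow> nat \<Rightarrow> bool" where
  "homogeneous_measure M d \<longleftrightarrow>
     (\<forall>l>0. (*\<^sub>R) l \<in> M \<rightarrow>\<^sub>M M \<and> M = density (distr M M ((*\<^sub>R) l)) (\<lambda>_. ennreal (l ^ d)))"

lemma homogeneous_measureD:
  assumes "homogeneous_measure M d" "l > 0"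
  shows "(*\<^sub>R) l \<in> M \<rightarrow>\<^sub>M M" "M = density (distr M M ((*\<^sub>R) l)) (\<lambda>_. ennreal (l ^ d))"
  using assms unfolding homogeneous_measure_def by auto

text \<open>
  The dilation by \<open>l\<close> is inverted by the one by \<open>inverse l\<close>, hence the equivalence.  It makes the
  change of variables below valid for every function: a non-measurable one stays
  non-measurable, and then both integrals have the default value zero.
\<close>

lemma measurable_dilation_iff:
  assumes "homogeneous_measure M d" "l > 0"
  shows "(\<lambda>x. f (l *\<^sub>R x)) \<in> M \<rightarrow>\<^sub>M N \<longleftrightarrow> f \<in> M \<rightarrow>\<^sub>M N"
proof
  assume "f \<in> M \<rightarrow>\<^sub>M N"
  then show "(\<lambda>x. f (l *\<^sub>R x)) \<in> M \<rightarrow>\<^sub>M N"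
    using homogeneous_measureD(1)[OF assms] by (rule measurable_compose[rotated])
next
  assume "(\<lambda>x. f (l *\<^sub>R x)) \<in> M \<rightarrow>\<^sub>M N"
  from measurable_compose[OF homogeneous_measureD(1)[OF assms(1), of "inverse l"] this]
  show "f \<in> M \<rightarrow>\<^sub>M N" using assms(2) by simp
qed

lemma nn_integral_dilation:
  assumes "homogeneous_measure M d" "l > 0" "f \<in> borel_measurable M"
  shows "(\<integral>\<^sup>+x. f x \<partial>M) = ennreal (l ^ d) * (\<integral>\<^sup>+x. f (l *\<^sub>R x) \<partial>M)"
proof -
  note [measurable] = homogeneous_measureD(1)[OF assms(1,2)] assms(3)
  have "(\<integral>\<^sup>+x. f x \<partial>M) = (\<integral>\<^sup>+x. f x \<partial>density (distr M M ((*\<^sub>R) l)) (\<lambda>_. ennreal (l ^ d)))"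
    using homogeneous_measureD(2)[OF assms(1,2)] by simp
  also have "\<dots> = (\<integral>\<^sup>+x. ennreal (l ^ d) * f (l *\<^sub>R x) \<partial>M)"
    by (simp add: nn_integral_density nn_integral_distr)
  also have "\<dots> = ennreal (l ^ d) * (\<integral>\<^sup>+x. f (l *\<^sub>R x) \<partial>M)"
    by (rule nn_integral_cmult) measurable
  finally show ?thesis .
qed

lemma integrable_dilation_iff:
  fixes f :: "'a::real_normed_vector \<Rightarrow> 'b::{banach, second_countable_topology}"
  assumes "homogeneous_measure M d" "l > 0"
  shows "integrable M (\<lambda>x. f (l *\<^sub>R x)) \<longleftrightarrow> integrable M f"
proof (cases "f \<in> borel_measurable M")
  case [measurable]: True
  note [measurable] = homogeneous_measureD(1)[OF assms]
  have "integrable M f \<longleftrightarrow> integrable (density (distr M M ((*\<^sub>R) l)) (\<lambda>_. ennreal (l ^ d))) f"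
    using homogeneous_measureD(2)[OF assms] by simp
  also have "\<dots> \<longleftrightarrow> integrable M (\<lambda>x. f (l *\<^sub>R x))"
  proof -
    have "integrable M (\<lambda>x. l ^ d *\<^sub>R f (l *\<^sub>R x)) \<longleftrightarrow> integrable M (\<lambda>x. f (l *\<^sub>R x))"
      using assms(2) integrable_scaleR_right[of "inverse (l ^ d)" M "\<lambda>x. l ^ d *\<^sub>R f (l *\<^sub>R x)"]
      by auto
    then show ?thesis
      using assms(2) by (subst integrable_density) (simp_all add: integrable_distr_eq)
  qed
  finally show ?thesis by simp
next
  case False
  then show ?thesis
    using measurable_dilation_iff[OF assms, of f] borel_measurable_integrable by blast
qed

lemma integral_dilation:
  fixes f :: "'a::real_normed_vector \<Rightarrow> 'b::{banach, second_countable_topology}"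
  assumes "homogeneous_measure M d" "l > 0"
  shows "(\<integral>x. f (l *\<^sub>R x) \<partial>M) = inverse (l ^ d) *\<^sub>R (\<integral>x. f x \<partial>M)"
proof (cases "f \<in> borel_measurable M")
  case [measurable]: True
  note [measurable] = homogeneous_measureD(1)[OF assms]
  have "(\<integral>x. f x \<partial>M) = (\<integral>x. f x \<partial>density (distr M M ((*\<^sub>R) l)) (\<lambda>_. ennreal (l ^ d)))"
    using homogeneous_measureD(2)[OF assms] by simp
  also have "\<dots> = l ^ d *\<^sub>R (\<integral>x. f (l *\<^sub>R x) \<partial>M)"
    using assms(2) by (subst integral_density) (simp_all add: integral_distr)
  finally show ?thesis using assms(2) by simp
next
  case False
  then have "\<not> integrable M f" by auto
  then show ?thesis
    using integrable_dilation_iff[OF assms, of f] by (simp add: not_integrable_integral_eq)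
qed

lemma homogeneous_lebesgue:
  "homogeneous_measure (lebesgue :: 'a::euclidean_space measure) DIM('a)"
  unfolding homogeneous_measure_def
proof (intro allI impI conjI)
  fix l :: real assume l: "l > 0"
  show "(*\<^sub>R) l \<in> (lebesgue :: 'a measure) \<rightarrow>\<^sub>M lebesgue" by measurable
  \<comment> \<open>the dilation in coordinates, as a special case of an affine map\<close>
  have T: "(\<lambda>x::'a. 0 + (\<Sum>j\<in>Basis. (l * (x \<bullet> j)) *\<^sub>R j)) = (*\<^sub>R) l"
    by (simp add: fun_eq_iff scaleR_sum_right[symmetric] euclidean_representation
        flip: scaleR_scaleR)
  show "(lebesgue :: 'a measure) = density (distr lebesgue lebesgue ((*\<^sub>R) l)) (\<lambda>_. ennreal (l ^ DIM('a)))"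
    using lebesgue_affine_euclidean[of "\<lambda>_::'a. l" 0] l unfolding T by simp
qed

section \<open>The weighted half-plane\<close>

lemma halfplane_sets [measurable]: "{p::real \<times> real. fst p > 0} \<in> sets lebesgue"
proof -
  have "open {p::real \<times> real. fst p > 0}"
    by (intro open_Collect_less continuous_intros)
  then show ?thesis by simp
qed

lemma space_mu5 [simp]: "space mu5 = {p. fst p > 0}"
  by (simp add: mu5_def)

lemma sets_mu5: "sets mu5 = sets (lebesgue_on {p. fst p > 0})"
  by (simp add: mu5_def)

lemma weight_measurable [measurable]:
  "(\<lambda>p::real \<times> real. ennreal (fst p ^ 3)) \<in> borel_measurable lebesgue"
proof -
  have "(\<lambda>p::real \<times> real. fst p ^ 3) \<in> borel_measurable borel"
    by (intro borel_measurable_continuous_onI continuous_intros)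
  then have "(\<lambda>p::real \<times> real. fst p ^ 3) \<in> borel_measurable lebesgue"
    by (simp add: measurable_completion)
  then show ?thesis by measurable
qed

lemma emeasure_mu5:
  assumes "A \<in> sets mu5"
  shows "emeasure mu5 A = (\<integral>\<^sup>+p. ennreal (fst p ^ 3) * indicator A p \<partial>lebesgue)"
proof -
  have A: "A \<in> sets (lebesgue_on {p. fst p > 0})" using assms by (simp add: sets_mu5)
  then have sub: "A \<subseteq> {p. fst p > 0}" using sets.sets_into_space by fastforce
  have "emeasure mu5 A = (\<integral>\<^sup>+p. (case p of (r, z) \<Rightarrow> ennreal (r ^ 3)) * indicator A p \<partial>lebesgue_on {p. fst p > 0})"
    unfolding mu5_def
    by (rule emeasure_density[OF _ A])
      (unfold split_beta, rule measurable_restrict_space1[OF weight_measurable])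
  also have "\<dots> = (\<integral>\<^sup>+p. ennreal (fst p ^ 3) * indicator A p * indicator {p. fst p > 0} p \<partial>lebesgue)"
    by (subst nn_integral_restrict_space) (simp_all add: split_beta halfplane_sets)
  also have "\<dots> = (\<integral>\<^sup>+p. ennreal (fst p ^ 3) * indicator A p \<partial>lebesgue)"
    using sub by (intro nn_integral_cong) (auto simp: indicator_def)
  finally show ?thesis .
qed

text \<open>The degree is two from the plane and three from the weight \<open>r\<^sup>3\<close>.\<close>

lemma homogeneous_mu5: "homogeneous_measure mu5 5"
  unfolding homogeneous_measure_def
proof (intro allI impI conjI)
  fix l :: real assume l: "l > 0"
  let ?H = "{p::real\<times>real. fst p > 0}"
  have T: "(*\<^sub>R) l \<in> lebesgue_on ?H \<rightarrow>\<^sub>M lebesgue_on ?H"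
    using l by (intro measurable_restrict_space3 lebesgue_measurable_scaling) auto
  then show [measurable]: "(*\<^sub>R) l \<in> mu5 \<rightarrow>\<^sub>M mu5"
    by (simp cong: measurable_cong_sets add: sets_mu5)
  show "mu5 = density (distr mu5 mu5 ((*\<^sub>R) l)) (\<lambda>_. ennreal (l ^ 5))"
  proof (rule measure_eqI)
    fix A assume A: "A \<in> sets mu5"
    then have "A \<in> sets (lebesgue_on ?H)" by (simp add: sets_mu5)
    then have AL [measurable]: "A \<in> sets lebesgue" and sub: "A \<subseteq> ?H"
      using sets_restrict_space_iff[of ?H lebesgue A] halfplane_sets by auto
    let ?B = "(*\<^sub>R) l -` A \<inter> space mu5"
    have B: "?B \<in> sets mu5" using A by measurable
    have "emeasure mu5 A = (\<integral>\<^sup>+p. ennreal (fst p ^ 3) * indicator A p \<partial>lebesgue)"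
      using A by (rule emeasure_mu5)
    also have "\<dots> = ennreal (l ^ 2) * (\<integral>\<^sup>+p. ennreal (fst (l *\<^sub>R p) ^ 3) * indicator A (l *\<^sub>R p) \<partial>lebesgue)"
      using nn_integral_dilation[OF homogeneous_lebesgue l, of "\<lambda>p::real\<times>real. ennreal (fst p ^ 3) * indicator A p"]
      by (simp add: power2_eq_square)
    also have "(\<integral>\<^sup>+p. ennreal (fst (l *\<^sub>R p) ^ 3) * indicator A (l *\<^sub>R p) \<partial>lebesgue)
        = (\<integral>\<^sup>+p. ennreal (l ^ 3) * (ennreal (fst p ^ 3) * indicator ?B p) \<partial>lebesgue)"
      using l sub by (intro nn_integral_cong)
        (auto simp: indicator_def power_mult_distrib ennreal_mult' zero_less_mult_iff)
    also have "\<dots> = ennreal (l ^ 3) * (\<integral>\<^sup>+p. ennreal (fst p ^ 3) * indicator ?B p \<partial>lebesgue)"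
    proof (rule nn_integral_cmult)
      have "?B \<in> sets lebesgue"
        using B sets_restrict_space_iff[of ?H lebesgue ?B] halfplane_sets by (simp add: sets_mu5)
      then show "(\<lambda>p. ennreal (fst p ^ 3) * indicator ?B p) \<in> borel_measurable lebesgue"
        by measurable
    qed
    also have "(\<integral>\<^sup>+p. ennreal (fst p ^ 3) * indicator ?B p \<partial>lebesgue) = emeasure mu5 ?B"
      using B by (rule emeasure_mu5[symmetric])
    also have "ennreal (l ^ 2) * (ennreal (l ^ 3) * emeasure mu5 ?B) = ennreal (l ^ 5) * emeasure mu5 ?B"
      using l by (simp add: mult.assoc[symmetric] ennreal_mult[symmetric] power_add[symmetric])
    also have "\<dots> = emeasure (density (distr mu5 mu5 ((*\<^sub>R) l)) (\<lambda>_. ennreal (l ^ 5))) A"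
      using A by (simp add: emeasure_density_const emeasure_distr)
    finally show "emeasure mu5 A = \<dots>" .
  qed simp
qed

text \<open>
  The relation between \<open>u\<close> and \<open>v\<close> is demanded only for \<open>r > 0\<close>, since classical derivatives, to
  which this is applied, are only controlled there.
\<close>

lemma L2_mu5_dilation:
  fixes u v :: "real \<times> real \<Rightarrow> 'a::euclidean_space"
  assumes l: "l > 0"
    and eq: "\<And>p. fst p > 0 \<Longrightarrow> v p = c *\<^sub>R u (l *\<^sub>R p)"
    and u: "L2_mu5 u"
  shows "L2_mu5 v" and "(L2_norm_mu5 v)\<^sup>2 = c\<^sup>2 / l ^ 5 * (L2_norm_mu5 u)\<^sup>2"
proof -
  note hom = homogeneous_mu5
  have n: "(norm (v p))\<^sup>2 = c\<^sup>2 * (norm (u (l *\<^sub>R p)))\<^sup>2" if "p \<in> space mu5" for p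
    using eq that by (simp add: power_mult_distrib)
  have "(\<lambda>p. c *\<^sub>R u (l *\<^sub>R p)) \<in> borel_measurable mu5"
    using u measurable_dilation_iff[OF hom l, of u borel] by (auto simp: L2_mu5_def)
  then have "v \<in> borel_measurable mu5"
    using eq by (subst measurable_cong[where g = "\<lambda>p. c *\<^sub>R u (l *\<^sub>R p)"]) auto
  moreover have "integrable mu5 (\<lambda>p. c\<^sup>2 * (norm (u (l *\<^sub>R p)))\<^sup>2)"
    using u integrable_dilation_iff[OF hom l, of "\<lambda>p. (norm (u p))\<^sup>2"] by (auto simp: L2_mu5_def)
  then have "integrable mu5 (\<lambda>p. (norm (v p))\<^sup>2)"
    using n by (subst Bochner_Integration.integrable_cong[OF refl]) auto
  ultimately show "L2_mu5 v" by (simp add: L2_mu5_def)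
  have sq: "(L2_norm_mu5 w)\<^sup>2 = (\<integral>p. (norm (w p))\<^sup>2 \<partial>mu5)" for w :: "real \<times> real \<Rightarrow> 'a"
    by (simp add: L2_norm_mu5_def)
  have "(L2_norm_mu5 v)\<^sup>2 = (\<integral>p. c\<^sup>2 * (norm (u (l *\<^sub>R p)))\<^sup>2 \<partial>mu5)"
    unfolding sq using n by (intro Bochner_Integration.integral_cong) auto
  also have "\<dots> = c\<^sup>2 / l ^ 5 * (L2_norm_mu5 u)\<^sup>2"
    unfolding sq using integral_dilation[OF hom l, of "\<lambda>p. (norm (u p))\<^sup>2"]
    by (simp add: field_simps)
  finally show "(L2_norm_mu5 v)\<^sup>2 = c\<^sup>2 / l ^ 5 * (L2_norm_mu5 u)\<^sup>2" .
qed

section \<open>Powers of the Laplacian\<close>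

lemma homogeneous_lebesgue_R5: "homogeneous_measure (lebesgue :: R5 measure) 5"
  using homogeneous_lebesgue[where 'a=R5] by simp

lemma fourier5_dilation:
  assumes "l > 0"
  shows "fourier5 (\<lambda>x. g (l *\<^sub>R x)) \<xi> = fourier5 g (\<xi> /\<^sub>R l) /\<^sub>R l ^ 5"
  using integral_dilation[OF homogeneous_lebesgue_R5 assms,
      of "\<lambda>y. cis (- ((\<xi> /\<^sub>R l) \<bullet> y)) * g y"] assms
  by (simp add: fourier5_def mult.assoc[symmetric])

lemma inv_fourier5_dilation:
  assumes "l > 0"
  shows "inv_fourier5 (\<lambda>\<xi>. h (\<xi> /\<^sub>R l)) x = l ^ 5 *\<^sub>R inv_fourier5 h (l *\<^sub>R x)"
  using integral_dilation[OF homogeneous_lebesgue_R5, of "inverse l"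
      "\<lambda>\<eta>. cis (\<eta> \<bullet> (l *\<^sub>R x)) * h \<eta>"] assms
  by (simp add: inv_fourier5_def scaleR_conv_of_real power_inverse mult.assoc[symmetric])

lemma inv_fourier5_scaleR: "inv_fourier5 (\<lambda>\<xi>. c *\<^sub>R h \<xi>) x = c *\<^sub>R inv_fourier5 h x"
  unfolding inv_fourier5_def mult_scaleR_right integral_scaleR_right
  by (simp add: scaleR_conv_of_real)

lemma AE_fst_R5_nonzero: "AE x in (lebesgue :: R5 measure). fst x \<noteq> 0"
proof -
  \<comment> \<open>The axis lies in a coordinate hyperplane.\<close>
  have "negligible {x::R5. (axis 1 1, 0) \<bullet> x = 0}"
    by (rule negligible_hyperplane) (simp add: zero_prod_def)
  then have "negligible {x::R5. fst x = 0}"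
    by (rule negligible_subset) auto
  then have "{x::R5. fst x = 0} \<in> null_sets lebesgue"
    by (simp add: negligible_iff_null_sets)
  then show ?thesis using AE_not_in by fastforce
qed

text \<open>
  The Jacobians \<open>l\<^bsup>-5\<^esup>\<close> and \<open>l\<^sup>5\<close> of the two Fourier integrals cancel.  What remains besides the
  amplitude \<open>c\<close> comes from the homogeneity of the symbol: \<open>|\<xi>|\<^bsup>2s\<^esup> = l\<^bsup>2s\<^esup> |\<xi> / l|\<^bsup>2s\<^esup>\<close>.
\<close>

lemma A_pow_dilation:
  fixes f g :: "real \<times> real \<Rightarrow> real"
  assumes l: "l > 0"
    and eq: "\<And>r z. r > 0 \<Longrightarrow> g (r, z) = c * f (l * r, l * z)"
    and f: "A_pow_defined s f"
  shows "A_pow_defined s g" and "A_pow s g p = (c * l powr (2 * s)) *\<^sub>R A_pow s f (l *\<^sub>R p)"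
proof -
  note hom = homogeneous_lebesgue_R5
  let ?L = "\<lambda>f::real\<times>real\<Rightarrow>real. lift5 (\<lambda>p. complex_of_real (f p))"
  have ae: "AE x in lebesgue. c * lift5 f (l *\<^sub>R x) = lift5 g x"
    using AE_fst_R5_nonzero by (rule eventually_mono) (use l in \<open>auto simp: lift5_def eq split_beta\<close>)
  have int_f: "integrable lebesgue (lift5 f)" and int_S: "integrable lebesgue (A_pow_symbol s f)"
    using f by (auto simp: A_pow_defined_def)
  have int_cf: "integrable lebesgue (\<lambda>x. c * lift5 f (l *\<^sub>R x))"
    using int_f integrable_dilation_iff[OF hom l, of "lift5 f"] by simp
  \<comment> \<open>completeness of Lebesgue measure: the values of \<open>g\<close> on the axis are arbitrary\<close>
  have meas_g: "lift5 g \<in> borel_measurable lebesgue"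
    by (rule borel_measurable_AE[OF borel_measurable_integrable[OF int_cf] ae])
  have int_g: "integrable lebesgue (lift5 g)"
    by (rule integrable_cong_AE_imp[OF int_cf meas_g ae])
  have L: "?L f = (\<lambda>x. complex_of_real (lift5 f x))" for f
    by (auto simp: lift5_def)
  \<comment> \<open>The integrands agree only almost everywhere, so \<open>fourier5_dilation\<close> applies after a change on a null set.\<close>
  have four: "fourier5 (?L g) \<xi> = (c / l ^ 5) *\<^sub>R fourier5 (?L f) (\<xi> /\<^sub>R l)" for \<xi>
  proof -
    have cis_meas: "(\<lambda>x::R5. cis (- (\<xi> \<bullet> x))) \<in> borel_measurable lebesgue"
    proof -
      have "(\<lambda>x::R5. cis (- (\<xi> \<bullet> x))) \<in> borel_measurable borel"
        by (intro borel_measurable_continuous_onI continuous_intros)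
      then show ?thesis by (simp add: measurable_completion)
    qed
    have "fourier5 (?L g) \<xi> = (\<integral>x. cis (- (\<xi> \<bullet> x)) * (c * complex_of_real (lift5 f (l *\<^sub>R x))) \<partial>lebesgue)"
      unfolding fourier5_def L
    proof (rule integral_cong_AE)
      show "AE x in lebesgue. cis (- (\<xi> \<bullet> x)) * complex_of_real (lift5 g x)
          = cis (- (\<xi> \<bullet> x)) * (c * complex_of_real (lift5 f (l *\<^sub>R x)))"
        using ae by (rule eventually_mono) (metis of_real_mult)
      show "(\<lambda>x. cis (- (\<xi> \<bullet> x)) * complex_of_real (lift5 g x)) \<in> borel_measurable lebesgue"
        using meas_g cis_meas by measurable
      have "(\<lambda>x. lift5 f (l *\<^sub>R x)) \<in> borel_measurable lebesgue"
        using borel_measurable_integrable[OF int_f]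
        by (simp only: measurable_dilation_iff[OF hom l, of "lift5 f" borel])
      then show "(\<lambda>x. cis (- (\<xi> \<bullet> x)) * (c * complex_of_real (lift5 f (l *\<^sub>R x)))) \<in> borel_measurable lebesgue"
        using cis_meas by measurable
    qed
    also have "\<dots> = c *\<^sub>R fourier5 (\<lambda>x. ?L f (l *\<^sub>R x)) \<xi>"
      by (simp add: fourier5_def L scaleR_conv_of_real mult.left_commute)
    also have "\<dots> = (c / l ^ 5) *\<^sub>R fourier5 (?L f) (\<xi> /\<^sub>R l)"
      using fourier5_dilation[OF l, of "?L f"] by (simp add: divide_inverse)
    finally show ?thesis .
  qed
  have sym: "A_pow_symbol s g = (\<lambda>\<xi>. (c * l powr (2 * s) / l ^ 5) *\<^sub>R A_pow_symbol s f (\<xi> /\<^sub>R l))"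
  proof
    fix \<xi> :: R5
    have "norm \<xi> powr (2 * s) = l powr (2 * s) * norm (\<xi> /\<^sub>R l) powr (2 * s)"
      using l by (simp add: powr_mult[symmetric] mult.assoc[symmetric])
    then show "A_pow_symbol s g \<xi> = (c * l powr (2 * s) / l ^ 5) *\<^sub>R A_pow_symbol s f (\<xi> /\<^sub>R l)"
      unfolding A_pow_symbol_def four scaleR_conv_of_real
      by (simp only: of_real_mult of_real_divide times_divide_eq_left times_divide_eq_right mult_ac)
  qed
  have "integrable lebesgue (A_pow_symbol s g)"
    using int_S integrable_dilation_iff[OF hom, of "inverse l" "A_pow_symbol s f"] l
    unfolding sym by simp
  with int_g show "A_pow_defined s g" by (simp add: A_pow_defined_def)
  have "inv_fourier5 (A_pow_symbol s g) x
      = (c * l powr (2 * s) / l ^ 5) *\<^sub>R inv_fourier5 (\<lambda>\<xi>. A_pow_symbol s f (\<xi> /\<^sub>R l)) x" for x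
    unfolding sym by (rule inv_fourier5_scaleR)
  then show "A_pow s g p = (c * l powr (2 * s)) *\<^sub>R A_pow s f (l *\<^sub>R p)"
    using l unfolding A_pow_def restrict5_def split_beta
    by (simp add: inv_fourier5_dilation[OF l])
qed

section \<open>Rescaled profiles\<close>

text \<open>
  Differentiability is essential: at other points \<^term>\<open>deriv\<close> has an unspecified value that
  does not scale.
\<close>

lemma deriv_dilation:
  fixes h :: "real \<Rightarrow> real"
  assumes "h differentiable at (l * x)"
  shows "deriv (\<lambda>s. c * h (l * s)) x = c * l * deriv h (l * x)"
proof -
  have "DERIV h (l * x) :> deriv h (l * x)"
    using assms by (simp add: DERIV_deriv_iff_real_differentiable)
  then have "DERIV (\<lambda>s. c * h (l * s)) x :> c * (deriv h (l * x) * l)"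
    by (auto intro!: derivative_eq_intros DERIV_chain'[of "\<lambda>s. l * s" l x UNIV h])
  then show ?thesis by (simp add: DERIV_imp_deriv mult.commute)
qed

lemma differentiable_partials:
  fixes f :: "real \<times> real \<Rightarrow> real"
  assumes "f differentiable at (r, z)"
  shows "(\<lambda>s. f (s, z)) differentiable at r" and "(\<lambda>w. f (r, w)) differentiable at z"
proof -
  have "(\<lambda>s::real. (s, z)) differentiable at r" "(\<lambda>w::real. (r, w)) differentiable at z"
    unfolding differentiable_def by (auto intro!: derivative_eq_intros exI)
  from this[THEN differentiable_chain_at, of f] assms
  show "(\<lambda>s. f (s, z)) differentiable at r" and "(\<lambda>w. f (r, w)) differentiable at z"
    by (simp_all add: o_def)
qed

lemma smooth_decaying_rescale:
  fixes f :: "real \<times> real \<Rightarrow> real"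
  assumes l: "l > 0" and f: "smooth_decaying \<beta> f"
  defines "g \<equiv> \<lambda>p. l\<^sup>2 * f (l *\<^sub>R p)"
  shows "smooth_decaying \<beta> g"
    and "(L2_norm_mu5 (grad g))\<^sup>2 = l * (L2_norm_mu5 (grad f))\<^sup>2"
    and "(L2_norm_mu5 (A_pow (- \<beta> / 2) (source g)))\<^sup>2
           = l powr (5 - 2 * \<beta>) * (L2_norm_mu5 (A_pow (- \<beta> / 2) (source f)))\<^sup>2"
proof -
  have diff: "f differentiable at (l * r, l * z)" if "r > 0" for r z
    using f l that by (simp add: smooth_decaying_def)
  have grad: "grad g p = l ^ 3 *\<^sub>R grad f (l *\<^sub>R p)" if "fst p > 0" for p
    using that deriv_dilation[OF differentiable_partials(1)[OF diff]]
      deriv_dilation[OF differentiable_partials(2)[OF diff]]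
    by (cases p) (simp add: grad_def g_def power2_eq_square power3_eq_cube)
  have source: "source g (r, z) = l ^ 5 * source f (l * r, l * z)" if "r > 0" for r z
  proof -
    have "(\<lambda>w. (f (l * r, w))\<^sup>2) differentiable at (l * z)"
      using differentiable_partials(2)[OF diff[OF that]] by (rule differentiable_power)
    \<comment> \<open>\<open>l ^ 4\<close> is the square of the amplitude \<open>l\<^sup>2\<close>.\<close>
    from deriv_dilation[OF this, of "l ^ 4"]
    have "deriv (\<lambda>w. l ^ 4 * (f (l * r, l * w))\<^sup>2) z = l ^ 4 * l * source f (l * r, l * z)"
      by (simp only: source_def prod.case)
    moreover have "(\<lambda>w. (g (r, w))\<^sup>2) = (\<lambda>w. l ^ 4 * (f (l * r, l * w))\<^sup>2)"
      by (simp add: g_def power_mult_distrib power_mult[symmetric])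
    moreover have "l ^ 4 * l = l ^ 5" by (simp add: power_Suc2[symmetric])
    ultimately show ?thesis by (simp only: source_def prod.case)
  qed
  have L2: "L2_mu5 (grad f)" "L2_mu5 (A_pow (- \<beta> / 2) (source f))"
    and Af: "A_pow_defined (- \<beta> / 2) (source f)"
    using f by (auto simp: smooth_decaying_def)
  have G: "L2_mu5 (grad g)"
    "(L2_norm_mu5 (grad g))\<^sup>2 = (l ^ 3)\<^sup>2 / l ^ 5 * (L2_norm_mu5 (grad f))\<^sup>2"
    using L2_mu5_dilation[OF l _ L2(1), of "grad g"] grad by blast+
  have A: "A_pow_defined (- \<beta> / 2) (source g)"
    "A_pow (- \<beta> / 2) (source g) p
       = (l ^ 5 * l powr (2 * (- \<beta> / 2))) *\<^sub>R A_pow (- \<beta> / 2) (source f) (l *\<^sub>R p)" for p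
    using A_pow_dilation[OF l _ Af, of "source g"] source by blast+
  note S = L2_mu5_dilation[OF l A(2) L2(2)]
  have "g differentiable at (r, z)" if "r > 0" for r z
  proof -
    have "(*\<^sub>R) l differentiable at (r, z)"
      by (simp add: bounded_linear_imp_differentiable bounded_linear_scaleR_right)
    from differentiable_chain_at[OF this] diff[OF that]
    show ?thesis unfolding g_def by (auto simp: o_def intro!: differentiable_mult)
  qed
  then show "smooth_decaying \<beta> g"
    using G(1) A(1) S(1) by (auto simp: smooth_decaying_def)
  have "(l ^ 3)\<^sup>2 / l ^ 5 = l" using l by (simp add: power_numeral_reduce)
  then show "(L2_norm_mu5 (grad g))\<^sup>2 = l * (L2_norm_mu5 (grad f))\<^sup>2"
    by (simp only: G(2))
  have "(l ^ 5 * l powr (2 * (- \<beta> / 2)))\<^sup>2 / l ^ 5 = l powr (5 - 2 * \<beta>)"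
  proof -
    have "(l ^ 5 * l powr (2 * (- \<beta> / 2)))\<^sup>2 / l ^ 5 = l ^ 5 * (l powr (- \<beta>))\<^sup>2"
      using l by (simp add: power2_eq_square)
    also have "\<dots> = l powr 5 * l powr (- (2 * \<beta>))"
      using l by (simp add: powr_numeral power2_eq_square powr_add[symmetric])
    also have "\<dots> = l powr (5 - 2 * \<beta>)" by (simp add: powr_add[symmetric])
    finally show ?thesis .
  qed
  then show "(L2_norm_mu5 (A_pow (- \<beta> / 2) (source g)))\<^sup>2
           = l powr (5 - 2 * \<beta>) * (L2_norm_mu5 (A_pow (- \<beta> / 2) (source f)))\<^sup>2"
    by (simp only: S(2))
qed

lemma slice_ns_rescale: "slice (ns_rescale l F) t = (\<lambda>p. l\<^sup>2 * slice F (l\<^sup>2 * t) (l *\<^sub>R p))"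
  by (auto simp: slice_def ns_rescale_def)

section \<open>Comparison of the exponents\<close>

text \<open>
  Any positive \<open>l \<noteq> 1\<close> separates exponents; the definition is used at time \<open>t / l\<^sup>2\<close> so that the
  unscaled term is evaluated at the given time \<open>t\<close>.
\<close>

lemma scales_like_unique:
  assumes "scales_like N I F p" "scales_like N I F q" "t \<in> I" "N (slice F t) \<noteq> 0"
  shows "p = q"
proof -
  have "2\<^sup>2 * (t / 4) = t" by simp
  then have "2 powr p * N (slice F t) = 2 powr q * N (slice F t)"
    using assms(1,2)[unfolded scales_like_def, rule_format, of 2 "t / 4"] assms(3) by auto
  then have "(2::real) powr p = 2 powr q" using assms(4) mult_right_cancel by blast
  then show ?thesis by (simp only: powr_inj)
qed

theorem proposition5p3:
  fixes \<beta> \<nu> m \<kappa> :: real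
    and F :: "real \<Rightarrow> real \<Rightarrow> real \<Rightarrow> real"
    and I :: "real set"
  assumes "\<beta> > 0" and "\<nu> > 0"
    and "\<And>t. t \<in> I \<Longrightarrow> smooth_decaying \<beta> (slice F t)"
  shows
    "(\<forall>l t. l > 0 \<longrightarrow> l\<^sup>2 * t \<in> I \<longrightarrow>
        smooth_decaying \<beta> (slice (ns_rescale l F) t) \<and>
        (L2_norm_mu5 (grad (slice (ns_rescale l F) t)))\<^sup>2
          = l * (L2_norm_mu5 (grad (slice F (l\<^sup>2 * t))))\<^sup>2 \<and>
        (L2_norm_mu5 (A_pow (- \<beta> / 2) (source (slice (ns_rescale l F) t))))\<^sup>2
          = l powr (5 - 2 * \<beta>)
            * (L2_norm_mu5 (A_pow (- \<beta> / 2) (source (slice F (l\<^sup>2 * t)))))\<^sup>2) \<and>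
     scales_like (viscous_term \<nu>) I F 1 \<and>
     scales_like (response_term m \<kappa> \<beta>) I F (5 - 2 * \<beta>) \<and>
     (5 - 2 * \<beta> = 1 \<longleftrightarrow> \<beta> = 2) \<and>
     (5 - 2 * \<beta> > 1 \<longleftrightarrow> \<beta> < 2) \<and>
     (5 - 2 * \<beta> < 1 \<longleftrightarrow> \<beta> > 2) \<and>
     (\<forall>p q. (\<exists>t\<in>I. viscous_term \<nu> (slice F t) \<noteq> 0) \<longrightarrow>
            (\<exists>t\<in>I. response_term m \<kappa> \<beta> (slice F t) \<noteq> 0) \<longrightarrow>
            scales_like (viscous_term \<nu>) I F p \<longrightarrow>
            scales_like (response_term m \<kappa> \<beta>) I F q \<longrightarrow>
            (q = p \<longleftrightarrow> \<beta> = 2) \<and> (q > p \<longleftrightarrow> \<beta> < 2) \<and> (q < p \<longleftrightarrow> \<beta> > 2))"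
    (is "?scaling \<and> ?visc \<and> ?resp \<and> ?crit \<and> ?super \<and> ?sub \<and> ?intrinsic")
proof -
  have scaling: ?scaling
    using smooth_decaying_rescale assms(3) unfolding slice_ns_rescale by blast
  then have visc: ?visc and resp: ?resp
    by (auto simp: scales_like_def viscous_term_def response_term_def)
  have ?intrinsic
  proof (intro allI impI)
    fix p q
    assume "\<exists>t\<in>I. viscous_term \<nu> (slice F t) \<noteq> 0"
      and "\<exists>t\<in>I. response_term m \<kappa> \<beta> (slice F t) \<noteq> 0"
      and "scales_like (viscous_term \<nu>) I F p"
      and "scales_like (response_term m \<kappa> \<beta>) I F q"
    then have "p = 1" "q = 5 - 2 * \<beta>"
      using scales_like_unique visc resp by blast+
    then show "(q = p \<longleftrightarrow> \<beta> = 2) \<and> (q > p \<longleftrightarrow> \<beta> < 2) \<and> (q < p \<longleftrightarrow> \<beta> > 2)" by auto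
  qed
  with scaling visc resp show ?thesis by auto
qed

end
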